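(* Let $\nu>-1$. Then for every integer $n\ge1$, $$\sum_{k \ge 1} \frac{\big(j_k^{\nu}\big)^2}{\Big[\big[(j_n^{\nu})'\big]^2- \big(j_k^{\nu}\big)^2\Big]^2} = \frac{1}{4} - \frac{\nu^2}{4\big[(j_n^{\nu})'\big]^2}.$$
   Context: $\{j_n^{\nu}: n\ge1\}$ denotes the sequence of strictly positive zeros, in ascending order, of the Bessel function of the first kind $J_\nu$. $\{(j_n^{\nu})': n\ge1\}$ denotes the sequence of strictly positive zeros, in ascending order, of the derivative $J_\nu'$ (also for $\nu=0$ only zeros in $(0,\infty)$ are counted); the prime in $(j_n^\nu)'$ is only notation. *)

theory Defs
  imports "HOL-Analysis.Analysis"
begin

(* J_nu on the half-line x > 0, by its power series at the origin. The values at x <= 0 carry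
   no meaning: powr is not the appropriate power there, and they are never used. *)
definition bessel_J :: "real \<Rightarrow> real \<Rightarrow> real" where
  "bessel_J \<nu> x =
     (\<Sum>m. (-1) ^ m / (fact m * Gamma (real m + \<nu> + 1)) * (x / 2) powr (2 * real m + \<nu>))"

(* The n-th strictly positive zero of f in ascending order, counted from n = 1: the zero x of f
   for which exactly n zeros lie in (0,x]. For n >= 1 the cardinality condition includes
   finiteness, since infinite sets have card 0. *)
definition pos_zero :: "(real \<Rightarrow> real) \<Rightarrow> nat \<Rightarrow> real" where
  "pos_zero f n = (THE x. 0 < x \<and> f x = 0 \<and> card {y. 0 < y \<and> y \<le> x \<and> f y = 0} = n)"

lemma pos_zero_eqI:
  fixes z :: "nat \<Rightarrow> real"
  assumes mono: "strict_mono_on {1..} z"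
    and img: "z ` {1..} = {x. 0 < x \<and> f x = 0}"
    and n: "1 \<le> n"
  shows "pos_zero f n = z n"
proof -
  have zero: "0 < z k \<and> f (z k) = 0" if "1 \<le> k" for k
    using img that by (auto simp: set_eq_iff)
  have card: "card {y. 0 < y \<and> y \<le> z k \<and> f y = 0} = k" if k: "1 \<le> k" for k
  proof -
    have "{y. 0 < y \<and> y \<le> z k \<and> f y = 0} = z ` {1..} \<inter> {..z k}"
      using img by auto
    also have "\<dots> = z ` {1..k}"
      using strict_mono_on_leD[OF mono] strict_mono_onD[OF mono] k
      by (fastforce simp: not_le[symmetric])
    finally have eq: "{y. 0 < y \<and> y \<le> z k \<and> f y = 0} = z ` {1..k}" .
    have "inj_on z {1..k}"
      using strict_mono_on_imp_inj_on[OF mono] by (rule inj_on_subset) auto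
    then show ?thesis
      by (simp add: eq card_image)
  qed
  show ?thesis
    unfolding pos_zero_def
  proof (rule the_equality)
    show "0 < z n \<and> f (z n) = 0 \<and> card {y. 0 < y \<and> y \<le> z n \<and> f y = 0} = n"
      using zero card n by blast
  next
    fix x assume x: "0 < x \<and> f x = 0 \<and> card {y. 0 < y \<and> y \<le> x \<and> f y = 0} = n"
    then obtain k where "1 \<le> k" "x = z k"
      using img by (auto simp: set_eq_iff image_iff)
    then show "x = z n"
      using x card by auto
  qed
qed

definition bessel_J_zero :: "real \<Rightarrow> nat \<Rightarrow> real" where
  "bessel_J_zero \<nu> = pos_zero (bessel_J \<nu>)"

definition bessel_J_deriv_zero :: "real \<Rightarrow> nat \<Rightarrow> real" where
  "bessel_J_deriv_zero \<nu> = pos_zero (deriv (bessel_J \<nu>))"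

end

theory Submission
  imports Defs "HOL-Complex_Analysis.Complex_Analysis"
begin

text \<open>
Write \<open>J\<^sub>\<nu> x = (x / 2) powr \<nu> * F (x\<^sup>2 / 4)\<close> with the entire function \<open>F = bessel_series \<nu>\<close>. The numbers
\<open>a = j\<^sup>2 / 4\<close>, for the positive zeros \<open>j\<close> of \<open>J\<^sub>\<nu>\<close>, are exactly the zeros of \<open>F\<close>, and with
\<open>z = x\<^sup>2 / 4\<close> the terms of the series are \<open>a / (4 * (a - z)\<^sup>2)\<close>, that is, one quarter of
\<open>1 / (a - z) + z / (a - z)\<^sup>2\<close>. Summed over all zeros, \<open>1 / (a - z)\<close> gives \<open>- F' / F\<close> and
\<open>1 / (a - z)\<^sup>2\<close> gives \<open>- (F' / F)'\<close>. At a positive zero \<open>x\<close> of the derivative of \<open>J\<^sub>\<nu>\<close> one has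
\<open>\<nu> * F + 2 * z * F' = 0\<close>, which determines \<open>F' / F\<close>, and Bessel's equation
\<open>z * F'' + (\<nu> + 1) * F' + F = 0\<close> determines \<open>F'' / F\<close>; the value of the sum follows by algebra
(\<open>bessel_series_zero_sum\<close>).

The analytic core is the partial fraction expansion \<open>log_deriv_expansion\<close>, valid for every entire
function with simple zeros that is nonzero at the origin and grows more slowly than
\<open>exp (\<epsilon> * norm z)\<close> for each positive \<open>\<epsilon>\<close>. After division by the zeros in a disc of radius \<open>R\<close>
the function has a logarithm there, whose real part is bounded above by a small multiple of \<open>R\<close>
plus a constant; the Borel-Caratheodory inequality and the Cauchy estimate bound the derivative
of that logarithm, which is the error of the partial sum.

Three facts about \<open>F\<close> complete the argument. Its zeros are real and positive by a Sturm-Liouville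
argument (\<open>bessel_series_zeros_positive\<close>), simple by the three-term recurrence
(\<open>bessel_series_zero_simple\<close>), and infinite in number, because otherwise \<open>F\<close> would grow like a
polynomial on the negative axis (\<open>infinite_bessel_series_zeros\<close>). Infinitude, with Rolle's theorem
for the derivative, ensures that the \<open>n\<close>-th zeros exist, so that \<open>pos_zero\<close> enumerates them
(\<open>pos_zero_bij_betw\<close>).
\<close>

section \<open>Logarithmic derivatives of entire functions of slow growth\<close>

text \<open>
Schwarz's lemma, applied to the image of \<open>h\<close> under the Moebius map \<open>w \<mapsto> w / (2 * A - w)\<close>,
which sends the half plane \<open>Re w < A\<close> into the unit disc and fixes the origin.
\<close>

lemma borel_caratheodory:
  assumes hol: "h holomorphic_on ball 0 R" and h0: "h 0 = 0" and R: "R > 0" and A: "A > 0"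
    and re: "\<And>z. norm z < R \<Longrightarrow> Re (h z) < A" and z: "norm z < R"
  shows "norm (h z) * (R - norm z) \<le> 2 * A * norm z"
proof -
  define p where "p = (\<lambda>w. h (of_real R * w) / (of_real (2 * A) - h (of_real R * w)))"
  have in_ball: "norm (of_real R * w) < R" if "norm w < 1" for w :: complex
    using that R by (simp add: norm_mult)
  have ne: "of_real (2 * A) - h w \<noteq> 0" if "norm w < R" for w
  proof
    assume "of_real (2 * A) - h w = 0"
    then have "Re (h w) = 2 * A"
      by (metis Re_complex_of_real eq_iff_diff_eq_0)
    with re[OF that] A show False by simp
  qed
  have lt: "norm (h w) < norm (of_real (2 * A) - h w)" if "norm w < R" for w
  proof -
    have "(norm (h w))\<^sup>2 < (norm (of_real (2 * A) - h w))\<^sup>2"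
      using mult_strict_left_mono[OF re[OF that] A]
      unfolding cmod_power2 by (simp add: power2_eq_square algebra_simps)
    then show ?thesis
      by (rule power2_less_imp_less) simp
  qed
  have "norm (p (z / of_real R)) \<le> norm (z / of_real R)"
  proof (rule Schwarz_Lemma(1))
    have "(\<lambda>w. h (of_real R * w)) holomorphic_on ball 0 1"
      using in_ball
      by (intro holomorphic_on_compose_gen[OF _ hol, unfolded o_def] holomorphic_intros) auto
    then show "p holomorphic_on ball 0 1"
      unfolding p_def using ne in_ball by (intro holomorphic_intros) auto
    show "p 0 = 0" by (simp add: p_def h0)
    show "norm (p w) < 1" if "norm w < 1" for w
      using lt[OF in_ball[OF that]] by (simp add: p_def norm_divide divide_simps)
    show "norm (z / of_real R) < 1"
      using z R by (simp add: norm_divide)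
  qed
  then have "norm (h z) / norm (of_real (2 * A) - h z) \<le> norm z / R"
    using R by (simp add: p_def norm_divide)
  then have "norm (h z) * R \<le> norm z * norm (of_real (2 * A) - h z)"
    using R ne[OF z] by (simp add: divide_simps mult.commute)
  also have "\<dots> \<le> norm z * (2 * A + norm (h z))"
    using norm_triangle_ineq4[of "of_real (2 * A)" "h z"] A
    by (intro mult_left_mono) auto
  finally show ?thesis by (simp add: algebra_simps)
qed

text \<open>
A zero-free \<open>G\<close> has a logarithm on the disc. The upper bound on \<open>norm G\<close> bounds its real part,
the Borel-Caratheodory inequality turns this into a bound on its modulus for radius \<open>R / 2\<close>, and
the Cauchy estimate on circles of radius \<open>R / 4\<close> into one on its derivative, which is \<open>G' / G\<close>.
\<close>

lemma log_deriv_bound_zero_free: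
  assumes hol: "G holomorphic_on ball 0 R" and R: "R > 0"
    and nz: "\<And>z. norm z < R \<Longrightarrow> G z \<noteq> 0"
    and bd: "\<And>z. norm z < R \<Longrightarrow> norm (G z) \<le> norm (G 0) * exp A" and A: "A \<ge> 0"
    and z: "norm z \<le> R / 4"
  shows "norm (deriv G z / G z) \<le> 8 * (A + 1) / R"
proof -
  obtain g where g: "g holomorphic_on ball 0 R" "\<And>w. w \<in> ball 0 R \<Longrightarrow> G w = exp (g w)"
    using contractible_imp_holomorphic_log[OF hol] nz
    by (metis convex_ball convex_imp_contractible dist_0_norm mem_ball)
  define h where "h = (\<lambda>w. g w - g 0)"
  have hol_h: "h holomorphic_on ball 0 R"
    unfolding h_def by (intro holomorphic_intros g)
  \<comment> \<open>The extra 1 makes the bound strict and positive, as the Borel-Caratheodory inequality needs.\<close>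
  have re: "Re (h w) < A + 1" if w: "norm w < R" for w
  proof -
    have "exp (Re (g w)) \<le> exp (Re (g 0) + A)"
      using bd[OF w] g(2)[of w] g(2)[of 0] w R by (simp add: exp_add)
    then show ?thesis by (simp add: h_def)
  qed
  have h_le: "norm (h w) \<le> 2 * (A + 1)" if w: "norm w \<le> R / 2" for w
  proof -
    have "norm (h w) * (R / 2) \<le> norm (h w) * (R - norm w)"
      using w by (intro mult_left_mono) auto
    also have "\<dots> \<le> 2 * (A + 1) * norm w"
      using w R A by (intro borel_caratheodory[OF hol_h _ R _ re]) (auto simp: h_def)
    also have "\<dots> \<le> 2 * (A + 1) * (R / 2)"
      using w A by (intro mult_left_mono) auto
    finally show ?thesis using R by simp
  qed
  have sub: "cball z (R / 4) \<subseteq> cball 0 (R / 2)"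
    using z by (simp add: cball_subset_cball_iff dist_norm)
  have sub': "cball z (R / 4) \<subseteq> ball 0 R"
    using sub R by (auto simp: subset_iff)
  have "norm ((deriv ^^ 1) h z) \<le> fact 1 * (2 * (A + 1)) / (R / 4) ^ 1"
  proof (rule Cauchy_inequality)
    show "h holomorphic_on ball z (R / 4)"
      using sub' ball_subset_cball by (intro holomorphic_on_subset[OF hol_h]) blast
    show "continuous_on (cball z (R / 4)) h"
      using sub' by (intro holomorphic_on_imp_continuous_on holomorphic_on_subset[OF hol_h])
    show "norm (h x) \<le> 2 * (A + 1)" if "norm (z - x) = R / 4" for x
      using sub that by (intro h_le) (auto simp: dist_norm subset_iff)
  qed (use R in auto)
  moreover have "deriv h z = deriv G z / G z"
  proof -
    have zin: "z \<in> ball 0 R" using z R by simp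
    have "(g has_field_derivative deriv g z) (at z)"
      using g(1) zin by (simp add: holomorphic_derivI)
    then have "(h has_field_derivative deriv g z) (at z)"
      unfolding h_def by (auto intro!: derivative_eq_intros)
    moreover have "((\<lambda>w. exp (g w)) has_field_derivative exp (g z) * deriv g z) (at z)"
      using \<open>(g has_field_derivative deriv g z) (at z)\<close> by (auto intro!: derivative_eq_intros)
    then have "(G has_field_derivative exp (g z) * deriv g z) (at z)"
      by (rule has_field_derivative_transform_within_open[of _ _ _ "ball 0 R"])
         (use g zin in auto)
    ultimately show ?thesis
      using g(2)[OF zin] by (simp add: DERIV_imp_deriv)
  qed
  ultimately show ?thesis by simp
qed

lemma entire_divide_finite_zeros:
  fixes F :: "complex \<Rightarrow> complex"
  assumes "finite Z" and "F holomorphic_on UNIV"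
    and "\<And>a. a \<in> Z \<Longrightarrow> F a = 0" and "0 \<notin> Z"
  shows "\<exists>G. G holomorphic_on UNIV \<and> (\<forall>z. F z = G z * (\<Prod>a\<in>Z. 1 - z / a))"
  using assms
proof (induction Z)
  case empty
  then show ?case by auto
next
  case (insert b Z)
  then obtain G where G: "G holomorphic_on UNIV" "\<And>z. F z = G z * (\<Prod>a\<in>Z. 1 - z / a)"
    by auto
  have b: "b \<noteq> 0" using insert by auto
  have "(\<Prod>a\<in>Z. 1 - b / a) \<noteq> 0"
    using insert by auto
  then have Gb: "G b = 0"
    using G(2)[of b] insert.prems by auto
  define H where "H = (\<lambda>z. - b * (if z = b then deriv G b else (G z - G b) / (z - b)))"
  have "H holomorphic_on UNIV"
    unfolding H_def by (intro holomorphic_intros pole_lemma_open G) auto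
  moreover have "G z = H z * (1 - z / b)" for z
    using b Gb by (auto simp: H_def divide_simps) (auto simp: algebra_simps)
  then have "F z = H z * (\<Prod>a\<in>insert b Z. 1 - z / a)" for z
    using insert by (simp add: G(2) mult.assoc)
  ultimately show ?case by blast
qed


lemma finite_zeros_cball:
  fixes F :: "complex \<Rightarrow> complex"
  assumes "F holomorphic_on UNIV" and "F w \<noteq> 0"
  shows "finite {a. F a = 0 \<and> norm a \<le> R}"
proof (cases "F constant_on UNIV")
  case True
  then have "F a \<noteq> 0" for a
    using assms(2) by (auto simp: constant_on_def)
  then show ?thesis by simp
next
  case False
  have "finite {a \<in> cball 0 R. F a = 0}"
    using assms False by (intro holomorphic_compact_finite_zeros[of F UNIV]) auto
  also have "{a \<in> cball 0 R. F a = 0} = {a. F a = 0 \<and> norm a \<le> R}" by auto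
  finally show ?thesis .
qed

text \<open>
Dividing \<open>F\<close> by the polynomial of its zeros in the disc of radius \<open>R\<close>, normalised to 1 at the
origin, leaves a function \<open>G\<close> that is zero-free on that disc, and \<open>h\<close> is \<open>G' / G\<close>. On the circle
of radius \<open>2 * R\<close> every factor \<open>1 - z / a\<close> of the polynomial has modulus at least 1, so by the
maximum principle \<open>G\<close> is bounded inside it by the bound for \<open>F\<close> on the circle.
\<close>

lemma partial_log_deriv_bound:
  fixes F :: "complex \<Rightarrow> complex"
  assumes hol: "F holomorphic_on UNIV" and F0: "F 0 \<noteq> 0"
    and simple: "\<And>a. F a = 0 \<Longrightarrow> deriv F a \<noteq> 0"
    and bd: "\<And>z. norm (F z) \<le> K * exp (\<epsilon> * norm z)" and \<epsilon>: "\<epsilon> \<ge> 0" and R: "R > 0"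
  defines "Z \<equiv> {a. F a = 0 \<and> norm a \<le> R}"
  obtains h where "h holomorphic_on ball 0 R"
    and "\<And>z. norm z \<le> R / 4 \<Longrightarrow> norm (h z) \<le> 8 * (ln (K / norm (F 0)) + 2 * \<epsilon> * R + 1) / R"
    and "\<And>z. norm z < R \<Longrightarrow> F z \<noteq> 0 \<Longrightarrow> h z = deriv F z / F z + (\<Sum>a\<in>Z. 1 / (a - z))"
proof -
  have finZ: "finite Z"
    unfolding Z_def using hol F0 by (rule finite_zeros_cball)
  have Z0: "0 \<notin> Z" using F0 by (simp add: Z_def)
  define P where "P = (\<lambda>z. \<Prod>a\<in>Z. 1 - z / a)"
  obtain G where G: "G holomorphic_on UNIV" and FG: "\<And>z. F z = G z * P z"
    using entire_divide_finite_zeros[OF finZ hol _ Z0] by (auto simp: Z_def P_def)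
  have K: "norm (F 0) \<le> K"
    using bd[of 0] by simp
  then have K0: "K > 0"
    using F0 by (meson less_le_trans zero_less_norm_iff)
  have holP: "P holomorphic_on UNIV"
    unfolding P_def using Z0 by (intro holomorphic_intros) auto
  have dG: "(G has_field_derivative deriv G z) (at z)" and dP: "(P has_field_derivative deriv P z) (at z)" for z
    using G holP by (auto intro: holomorphic_derivI)
  have dF: "deriv F z = deriv G z * P z + G z * deriv P z" for z
  proof -
    have "((\<lambda>z. G z * P z) has_field_derivative deriv G z * P z + G z * deriv P z) (at z)"
      by (auto intro!: derivative_eq_intros dG dP)
    moreover have "(\<lambda>z. G z * P z) = F" using FG by auto
    ultimately show ?thesis by (simp add: DERIV_imp_deriv)
  qed
  \<comment> \<open>A common zero of G and P would be a multiple zero of F.\<close>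
  have Gnz: "G z \<noteq> 0" if z: "norm z \<le> R" for z
  proof
    assume "G z = 0"
    then have Fz: "F z = 0" by (simp add: FG)
    then have "z \<in> Z" using z by (simp add: Z_def)
    then have "P z = 0" using Z0 finZ by (force simp: P_def)
    then show False using simple[OF Fz] \<open>G z = 0\<close> by (simp add: dF)
  qed
  have P_ge: "norm (P z) \<ge> 1" if z: "norm z = 2 * R" for z
  proof -
    have "norm (1 - z / a) \<ge> 1" if a: "a \<in> Z" for a
    proof -
      have a0: "a \<noteq> 0" using a Z0 by auto
      have "2 * norm a \<le> norm z" using a z by (simp add: Z_def)
      then have "2 \<le> norm (z / a)"
        using a0 by (simp add: norm_divide divide_simps)
      then show ?thesis
        using norm_triangle_ineq2[of "z / a" 1] by (simp add: norm_minus_commute)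
    qed
    then show ?thesis
      by (auto simp: P_def prod_norm[symmetric] intro!: prod_ge_1)
  qed
  have G_le: "norm (G z) \<le> K * exp (\<epsilon> * (2 * R))" if z: "norm z \<le> 2 * R" for z
  proof (rule maximum_modulus_frontier[of G "cball 0 (2 * R)"])
    show "norm (G w) \<le> K * exp (\<epsilon> * (2 * R))" if "w \<in> frontier (cball 0 (2 * R))" for w
    proof -
      have w: "norm w = 2 * R" using that R by (simp add: frontier_cball)
      have "norm (G w) * 1 \<le> norm (G w) * norm (P w)"
        using P_ge[OF w] by (intro mult_left_mono) auto
      also have "\<dots> \<le> K * exp (\<epsilon> * (2 * R))"
        using bd[of w] w by (simp add: FG norm_mult)
      finally show ?thesis by simp
    qed
    show "continuous_on (closure (cball 0 (2 * R))) G"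
      using G by (intro holomorphic_on_imp_continuous_on) (auto intro: holomorphic_on_subset)
  qed (use z G in \<open>auto intro: holomorphic_on_subset\<close>)
  have G0: "G 0 = F 0" by (simp add: FG P_def)
  define A where "A = ln (K / norm (F 0)) + 2 * \<epsilon> * R"
  have A0: "A \<ge> 0"
    unfolding A_def using K F0 \<epsilon> R by (intro add_nonneg_nonneg ln_ge_zero) (auto simp: divide_simps)
  have exp_A: "norm (G 0) * exp A = K * exp (\<epsilon> * (2 * R))"
    using K0 F0 by (simp add: A_def exp_add G0 mult_ac)
  define h where "h = (\<lambda>z. deriv G z / G z)"
  show thesis
  proof
    show "h holomorphic_on ball 0 R"
      unfolding h_def using Gnz G
      by (intro holomorphic_intros holomorphic_on_subset[OF G] holomorphic_on_subset[OF holomorphic_deriv[OF G]])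
         auto
    show "norm (h z) \<le> 8 * (ln (K / norm (F 0)) + 2 * \<epsilon> * R + 1) / R" if "norm z \<le> R / 4" for z
      unfolding h_def A_def[symmetric]
    proof (rule log_deriv_bound_zero_free)
      show "norm (G w) \<le> norm (G 0) * exp A" if "norm w < R" for w
        unfolding exp_A using that R by (intro G_le) simp
    qed (use that G Gnz R A0 in \<open>auto intro: holomorphic_on_subset\<close>)
    show "h z = deriv F z / F z + (\<Sum>a\<in>Z. 1 / (a - z))" if "norm z < R" and Fz: "F z \<noteq> 0" for z
    proof -
      have az: "a \<noteq> z \<and> a \<noteq> 0" if "a \<in> Z" for a
        using that Fz Z0 by (auto simp: Z_def)
      have fac: "1 - z / a \<noteq> 0" if "a \<in> Z" for a
        using az[OF that] by (auto simp: divide_simps)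
      have "(P has_field_derivative (\<Prod>a\<in>Z. 1 - z / a) * (\<Sum>a\<in>Z. (- 1 / a) / (1 - z / a))) (at z)"
        unfolding P_def using fac az
        by (intro has_field_derivative_prod') (auto intro!: derivative_eq_intros)
      then have "deriv P z = P z * (\<Sum>a\<in>Z. (- 1 / a) / (1 - z / a))"
        by (simp add: DERIV_imp_deriv P_def)
      also have "(\<Sum>a\<in>Z. (- 1 / a) / (1 - z / a)) = - (\<Sum>a\<in>Z. 1 / (a - z))"
        unfolding sum_negf[symmetric]
      proof (rule sum.cong[OF refl])
        fix a assume a: "a \<in> Z"
        show "(- 1 / a) / (1 - z / a) = - (1 / (a - z))"
          using az[OF a] fac[OF a] by (simp add: divide_simps)
      qed
      finally have "deriv P z = - P z * (\<Sum>a\<in>Z. 1 / (a - z))" by simp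
      moreover have "G z \<noteq> 0" "P z \<noteq> 0" using Fz by (auto simp: FG)
      ultimately show ?thesis by (simp add: h_def dF FG add_divide_distrib divide_simps)
    qed
  qed
qed

text \<open>
The Hadamard factorisation of an entire function of exponential type zero, in logarithmic form.
The error term \<open>h\<close> of the partial sum at radius \<open>R\<close> is bounded by a constant
divided by \<open>R\<close> plus a multiple of \<open>\<epsilon>\<close>, with \<open>\<epsilon>\<close> arbitrary; its derivative, which is the error
for the squared terms, is then small by the Cauchy estimate. The limits are taken along discs
because the series of \<open>1 / (a - z)\<close> need not converge absolutely under these hypotheses.
\<close>

theorem log_deriv_expansion:
  fixes F :: "complex \<Rightarrow> complex"
  assumes hol: "F holomorphic_on UNIV" and F0: "F 0 \<noteq> 0"
    and simple: "\<And>a. F a = 0 \<Longrightarrow> deriv F a \<noteq> 0"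
    and type: "\<And>\<epsilon>. \<epsilon> > 0 \<Longrightarrow> \<exists>K. \<forall>z. norm (F z) \<le> K * exp (\<epsilon> * norm z)"
    and Fz: "F z \<noteq> 0"
  shows "((\<lambda>R. \<Sum>a | F a = 0 \<and> norm a \<le> R. 1 / (a - z)) \<longlongrightarrow> - deriv F z / F z) at_top"
    and "((\<lambda>R. \<Sum>a | F a = 0 \<and> norm a \<le> R. 1 / (a - z)\<^sup>2) \<longlongrightarrow>
            ((deriv F z)\<^sup>2 - F z * deriv (deriv F) z) / (F z)\<^sup>2) at_top"
proof -
  let ?S1 = "\<lambda>R. \<Sum>a | F a = 0 \<and> norm a \<le> R. 1 / (a - z)"
  let ?S2 = "\<lambda>R. \<Sum>a | F a = 0 \<and> norm a \<le> R. 1 / (a - z)\<^sup>2"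
  let ?L1 = "- deriv F z / F z"
  let ?L2 = "((deriv F z)\<^sup>2 - F z * deriv (deriv F) z) / (F z)\<^sup>2"
  have key: "\<forall>\<^sub>F R in at_top. norm (?S1 R - ?L1) < e \<and> norm (?S2 R - ?L2) < e" if e: "e > 0" for e
  proof -
    \<comment> \<open>The error bound is C / R + 16 * eps; this choice makes its second part e / 2.\<close>
    define \<epsilon> where "\<epsilon> = e / 32"
    have \<epsilon>: "\<epsilon> > 0" using e by (simp add: \<epsilon>_def)
    obtain K where K: "\<And>z. norm (F z) \<le> K * exp (\<epsilon> * norm z)"
      using type[OF \<epsilon>] by auto
    define C where "C = 8 * (ln (K / norm (F 0)) + 1)"
    have lim: "((\<lambda>R. C / R) \<longlongrightarrow> 0) at_top"
      by (intro tendsto_divide_0[OF tendsto_const] filterlim_at_top_imp_at_infinity filterlim_ident)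
    have small: "\<forall>\<^sub>F R in at_top. C / R < e / 2"
      using order_tendstoD(2)[OF lim, of "e / 2"] e by simp
    have "\<forall>\<^sub>F R in at_top. R \<ge> 4 * (norm z + 1)" by (rule eventually_ge_at_top)
    with small show ?thesis
    proof eventually_elim
      case (elim R)
      define Z where "Z = {a. F a = 0 \<and> norm a \<le> R}"
      have R: "R > 0" by (rule less_le_trans[OF _ elim(2)]) (simp add: add_nonneg_pos)
      obtain h where h: "h holomorphic_on ball 0 R"
        and hb: "\<And>w. norm w \<le> R / 4 \<Longrightarrow> norm (h w) \<le> 8 * (ln (K / norm (F 0)) + 2 * \<epsilon> * R + 1) / R"
        and hF: "\<And>w. norm w < R \<Longrightarrow> F w \<noteq> 0 \<Longrightarrow> h w = deriv F w / F w + (\<Sum>a\<in>Z. 1 / (a - w))"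
        unfolding Z_def by (rule partial_log_deriv_bound[OF hol F0 simple K less_imp_le[OF \<epsilon>] R]) auto
      have "8 * (ln (K / norm (F 0)) + 2 * \<epsilon> * R + 1) / R = C / R + e / 2"
        using R by (simp add: C_def \<epsilon>_def field_simps)
      then have h_less: "norm (h w) \<le> C / R + e / 2" if "norm w \<le> R / 4" for w
        using hb[OF that] by simp
      have Ce: "C / R + e / 2 < e" using elim(1) by linarith
      have zR: "norm z < R" "norm z + 1 \<le> R / 4" using elim(2) R by auto
      have "?S1 R - ?L1 = h z"
        using hF[OF zR(1) Fz] by (simp add: Z_def)
      moreover have "norm (h z) < e"
        using h_less[of z] zR Ce by simp
      moreover have "norm (deriv h z) < e"
      proof -
        have sub: "cball z 1 \<subseteq> ball 0 R"
        proof
          fix w assume "w \<in> cball z 1"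
          then show "w \<in> ball 0 R"
            using norm_triangle_ineq2[of w z] zR R by (simp add: dist_norm norm_minus_commute)
        qed
        have "norm ((deriv ^^ 1) h z) \<le> fact 1 * (C / R + e / 2) / 1 ^ 1"
        proof (rule Cauchy_inequality)
          show "h holomorphic_on ball z 1"
            using sub ball_subset_cball by (intro holomorphic_on_subset[OF h]) blast
          show "continuous_on (cball z 1) h"
            using sub by (intro holomorphic_on_imp_continuous_on holomorphic_on_subset[OF h])
          show "norm (h w) \<le> C / R + e / 2" if "norm (z - w) = 1" for w
            using that zR norm_triangle_ineq2[of w z] by (intro h_less) (simp add: norm_minus_commute)
        qed auto
        then show ?thesis using Ce by simp
      qed
      moreover have "?S2 R - ?L2 = deriv h z"
      proof -
        have finZ: "finite Z"
          unfolding Z_def using hol F0 by (rule finite_zeros_cball)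
        define U where "U = ball 0 R \<inter> {w. F w \<noteq> 0}"
        have "open {w. F w \<noteq> 0}"
          using holomorphic_on_imp_continuous_on[OF hol] by (intro open_Collect_neq) auto
        then have U: "open U" "z \<in> U" using zR Fz by (auto simp: U_def)
        have d: "(F has_field_derivative deriv F z) (at z)"
          "(deriv F has_field_derivative deriv (deriv F) z) (at z)"
          using holomorphic_derivI[OF hol] holomorphic_derivI[OF holomorphic_deriv[OF hol]] by auto
        have az: "a - z \<noteq> 0" if "a \<in> Z" for a
          using that Fz by (auto simp: Z_def)
        have "((\<lambda>w. \<Sum>a\<in>Z. 1 / (a - w)) has_field_derivative (\<Sum>a\<in>Z. 1 / (a - z)\<^sup>2)) (at z)"
          using az by (intro DERIV_sum) (auto intro!: derivative_eq_intros simp: power2_eq_square)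
        moreover have "((\<lambda>w. deriv F w / F w) has_field_derivative - ?L2) (at z)"
          using Fz by (auto intro!: derivative_eq_intros d simp: power2_eq_square minus_divide_left)
        ultimately have "((\<lambda>w. deriv F w / F w + (\<Sum>a\<in>Z. 1 / (a - w))) has_field_derivative
              - ?L2 + (\<Sum>a\<in>Z. 1 / (a - z)\<^sup>2)) (at z)"
          by (intro DERIV_add)
        then have "(h has_field_derivative - ?L2 + (\<Sum>a\<in>Z. 1 / (a - z)\<^sup>2)) (at z)"
          by (rule has_field_derivative_transform_within_open[OF _ U]) (simp add: U_def hF)
        then show ?thesis
          by (simp add: DERIV_imp_deriv Z_def)
      qed
      ultimately show ?case by simp
    qed
  qed
  show "(?S1 \<longlongrightarrow> ?L1) at_top"
    unfolding tendsto_iff dist_norm by (intro allI impI) (rule eventually_mono[OF key], auto)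
  show "(?S2 \<longlongrightarrow> ?L2) at_top"
    unfolding tendsto_iff dist_norm by (intro allI impI) (rule eventually_mono[OF key], auto)
qed

section \<open>The power series of the Bessel function\<close>

definition bessel_coeff :: "real \<Rightarrow> nat \<Rightarrow> real" where
  "bessel_coeff \<nu> m = (-1) ^ m / (fact m * Gamma (real m + \<nu> + 1))"

text \<open>
For positive \<open>x\<close>, \<open>J\<^sub>\<nu> x = (x / 2) powr \<nu> * bessel_series \<nu> (x\<^sup>2 / 4)\<close>: removing the branch point and
passing to the square leaves an entire function of order one half. The type is generic since the
derivative of \<open>J\<^sub>\<nu>\<close> needs the real function and the zeros need the complex one.
\<close>

definition bessel_series :: "real \<Rightarrow> 'a :: {real_normed_field, banach} \<Rightarrow> 'a" where
  "bessel_series \<nu> z = (\<Sum>m. of_real (bessel_coeff \<nu> m) * z ^ m)"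

lemma Gamma_shift_pos: "\<nu> > -1 \<Longrightarrow> Gamma (real m + \<nu> + 1) > 0"
  by (intro Gamma_real_pos) auto

lemma Gamma_shift_Suc:
  assumes "\<nu> > -1"
  shows "Gamma (real (Suc m) + \<nu> + 1) = (real m + \<nu> + 1) * Gamma (real m + \<nu> + 1)"
proof -
  have "real m + \<nu> + 1 \<notin> \<int>\<^sub>\<le>\<^sub>0"
    using assms nonpos_Ints_nonpos[of "real m + \<nu> + 1"] by force
  then show ?thesis
    using Gamma_plus1[of "real m + \<nu> + 1"] by (simp add: add_ac)
qed

lemma bessel_coeff_nonzero:
  assumes "\<nu> > -1"
  shows "bessel_coeff \<nu> m \<noteq> 0"
  using Gamma_shift_pos[OF assms, of m] by (simp add: bessel_coeff_def)

lemma bessel_coeff_diffs: "diffs (bessel_coeff \<nu>) m = - bessel_coeff (\<nu> + 1) m"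
  by (simp add: diffs_def bessel_coeff_def divide_simps add_ac)

text \<open>
The factor \<open>1 / Gamma (m + \<nu> + 1)\<close> decays faster than any geometric sequence, by the ratio test.
Hence the series is dominated by that of \<open>K * exp (\<epsilon> * norm z)\<close> for every \<open>\<epsilon>\<close>, which gives both
convergence everywhere and exponential type zero.
\<close>

lemma bessel_coeff_exp_bound:
  assumes \<nu>: "\<nu> > -1" and \<epsilon>: "\<epsilon> > 0"
  obtains K where "\<And>m. \<bar>bessel_coeff \<nu> m\<bar> \<le> K * \<epsilon> ^ m / fact m"
proof -
  define d where "d = (\<lambda>m. 1 / (\<epsilon> ^ m * Gamma (real m + \<nu> + 1)))"
  have G: "Gamma (real m + \<nu> + 1) > 0" for m
    by (rule Gamma_shift_pos[OF \<nu>])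
  obtain N where N: "real N \<ge> 2 / \<epsilon>"
    using real_arch_simple by blast
  have "summable d"
  proof (rule summable_ratio_test[of "1/2" "Suc N"])
    fix m assume m: "m \<ge> Suc N"
    have "2 / \<epsilon> \<le> real m + \<nu> + 1"
      using N m \<nu> by linarith
    then have le: "2 \<le> \<epsilon> * (real m + \<nu> + 1)"
      using \<epsilon> by (simp add: divide_simps mult.commute)
    have "d (Suc m) = d m / (\<epsilon> * (real m + \<nu> + 1))"
      unfolding d_def Gamma_shift_Suc[OF \<nu>] by simp
    then have "norm (d (Suc m)) = norm (d m) / (\<epsilon> * (real m + \<nu> + 1))"
      using le by simp
    also have "\<dots> \<le> norm (d m) / 2"
      using le by (intro divide_left_mono) auto
    finally show "norm (d (Suc m)) \<le> 1 / 2 * norm (d m)" by simp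
  qed simp
  then have "Bseq d"
    by (meson summable_LIMSEQ_zero convergentI convergent_imp_Bseq)
  then obtain K where K: "K > 0" "\<And>m. norm (d m) \<le> K"
    by (auto simp: Bseq_def)
  show thesis
  proof
    show "\<bar>bessel_coeff \<nu> m\<bar> \<le> K * \<epsilon> ^ m / fact m" for m
    proof -
      have "\<bar>bessel_coeff \<nu> m\<bar> = norm (d m) * \<epsilon> ^ m / fact m"
        using G[of m] \<epsilon> by (simp add: bessel_coeff_def d_def abs_mult)
      also have "\<dots> \<le> K * \<epsilon> ^ m / fact m"
        using K \<epsilon> by (intro divide_right_mono mult_right_mono) auto
      finally show ?thesis .
    qed
  qed
qed

lemma bessel_series_exp_bound:
  fixes z :: "'a :: {real_normed_field, banach}"
  assumes K: "\<And>m. \<bar>bessel_coeff \<nu> m\<bar> \<le> K * \<epsilon> ^ m / fact m"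
  shows "summable (\<lambda>m. of_real (bessel_coeff \<nu> m) * z ^ m)"
    and "norm (bessel_series \<nu> z) \<le> K * exp (\<epsilon> * norm z)"
proof -
  have le: "norm (of_real (bessel_coeff \<nu> m) * z ^ m) \<le> K * ((\<epsilon> * norm z) ^ m /\<^sub>R fact m)" for m
    using mult_right_mono[OF K[of m], of "norm z ^ m"]
    by (simp add: norm_mult norm_power power_mult_distrib divide_simps)
  have s: "summable (\<lambda>m. K * ((\<epsilon> * norm z) ^ m /\<^sub>R fact m))"
    by (intro summable_mult summable_exp_generic)
  show "summable (\<lambda>m. of_real (bessel_coeff \<nu> m) * z ^ m)"
    by (rule summable_comparison_test'[OF s le])
  have "norm (bessel_series \<nu> z) \<le> (\<Sum>m. K * ((\<epsilon> * norm z) ^ m /\<^sub>R fact m))"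
    unfolding bessel_series_def by (rule norm_suminf_le[OF le s])
  also have "\<dots> = K * exp (\<epsilon> * norm z)"
    unfolding exp_def by (intro suminf_mult summable_exp_generic)
  finally show "norm (bessel_series \<nu> z) \<le> K * exp (\<epsilon> * norm z)" .
qed

lemma summable_bessel_series:
  fixes z :: "'a :: {real_normed_field, banach}"
  assumes "\<nu> > -1"
  shows "summable (\<lambda>m. of_real (bessel_coeff \<nu> m) * z ^ m)"
proof -
  obtain K where "\<And>m. \<bar>bessel_coeff \<nu> m\<bar> \<le> K * 1 ^ m / fact m"
    using bessel_coeff_exp_bound[OF assms zero_less_one] by blast
  then show ?thesis by (rule bessel_series_exp_bound(1))
qed

lemma has_field_derivative_bessel_series:
  assumes "\<nu> > -1"
  shows "(bessel_series \<nu> has_field_derivative - bessel_series (\<nu> + 1) z) (at z)"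
proof -
  have "diffs (\<lambda>m. of_real (bessel_coeff \<nu> m) :: 'a) m = - of_real (bessel_coeff (\<nu> + 1) m)" for m
    using bessel_coeff_diffs[of \<nu> m] by (metis diffs_of_real of_real_minus)
  then have "(\<Sum>m. diffs (\<lambda>m. of_real (bessel_coeff \<nu> m)) m * z ^ m) = - bessel_series (\<nu> + 1) z"
    using suminf_minus[OF summable_bessel_series[of "\<nu> + 1" z]] assms by (simp add: bessel_series_def)
  then show ?thesis
    using termdiffs_strong_converges_everywhere[OF summable_bessel_series[OF assms], of z]
    by (simp add: bessel_series_def[abs_def])
qed

lemma deriv_bessel_series:
  "\<nu> > -1 \<Longrightarrow> deriv (bessel_series \<nu>) z = - bessel_series (\<nu> + 1) z"
  by (rule DERIV_imp_deriv[OF has_field_derivative_bessel_series])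

lemma deriv_deriv_bessel_series:
  fixes z :: "'a :: {real_normed_field, banach}"
  assumes "\<nu> > -1"
  shows "deriv (deriv (bessel_series \<nu>)) z = bessel_series (\<nu> + 2) z"
proof -
  have "deriv (bessel_series \<nu>) = (\<lambda>z :: 'a. - bessel_series (\<nu> + 1) z)"
    by (rule ext) (rule deriv_bessel_series[OF assms])
  moreover have "((\<lambda>z :: 'a. - bessel_series (\<nu> + 1) z) has_field_derivative bessel_series (\<nu> + 1 + 1) z) (at z)"
    using DERIV_minus[OF has_field_derivative_bessel_series[of "\<nu> + 1" z]] assms by simp
  ultimately show ?thesis
    by (simp add: DERIV_imp_deriv add.assoc)
qed

lemma holomorphic_bessel_series [holomorphic_intros]:
  "\<nu> > -1 \<Longrightarrow> bessel_series \<nu> holomorphic_on A"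
  by (auto simp: holomorphic_on_def field_differentiable_def
           intro: has_field_derivative_at_within has_field_derivative_bessel_series)

lemma bessel_series_of_real:
  assumes "\<nu> > -1"
  shows "bessel_series \<nu> (of_real x :: complex) = of_real (bessel_series \<nu> x)"
  using suminf_of_real[OF summable_bessel_series[OF assms, of x], where 'a = complex]
  by (simp add: bessel_series_def)

lemma bessel_series_0: "bessel_series \<nu> 0 = of_real (bessel_coeff \<nu> 0)"
  unfolding bessel_series_def by (simp add: powser_zero)

lemma bessel_series_0_nonzero:
  "\<nu> > -1 \<Longrightarrow> bessel_series \<nu> (0 :: 'a :: {real_normed_field, banach}) \<noteq> 0"
  by (simp add: bessel_series_0 bessel_coeff_nonzero)

text \<open>
With \<open>F\<close> for \<open>bessel_series \<nu>\<close>, this is Bessel's equation \<open>z * F'' + (\<nu> + 1) * F' + F = 0\<close>, since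
differentiation raises the order by one and changes the sign.
\<close>

lemma bessel_series_recurrence:
  fixes z :: "'a :: {real_normed_field, banach}"
  assumes \<nu>: "\<nu> > -1"
  shows "z * bessel_series (\<nu> + 2) z - of_real (\<nu> + 1) * bessel_series (\<nu> + 1) z + bessel_series \<nu> z = 0"
proof -
  define b where "b = (\<lambda>m. if m = 0 then 0 else bessel_coeff (\<nu> + 2) (m - 1))"
  have coeff: "b m = (\<nu> + 1) * bessel_coeff (\<nu> + 1) m - bessel_coeff \<nu> m" for m
  proof -
    have G1: "Gamma (real m + (\<nu> + 1) + 1) = (real m + \<nu> + 1) * Gamma (real m + \<nu> + 1)"
      using Gamma_shift_Suc[OF \<nu>, of m] by (simp add: add_ac)
    have pos: "real m + \<nu> + 1 > 0" using \<nu> by linarith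
    define D where "D = fact m * Gamma (real m + (\<nu> + 1) + 1)"
    have "bessel_coeff \<nu> m = (-1) ^ m * (real m + \<nu> + 1) / D"
      unfolding D_def G1 bessel_coeff_def using pos by simp
    moreover have "bessel_coeff (\<nu> + 1) m = (-1) ^ m / D"
      by (simp add: D_def bessel_coeff_def)
    ultimately have "(\<nu> + 1) * bessel_coeff (\<nu> + 1) m - bessel_coeff \<nu> m = (-1) ^ m * (- real m) / D"
      by (simp add: diff_divide_distrib[symmetric] algebra_simps)
    also have "\<dots> = b m"
    proof (cases m)
      case (Suc n)
      have "Gamma (real m + (\<nu> + 1) + 1) = Gamma (real n + (\<nu> + 2) + 1)"
        by (simp add: Suc add_ac)
      then show ?thesis
        by (simp add: D_def b_def bessel_coeff_def Suc divide_simps) (simp add: algebra_simps)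
    qed (simp add: b_def)
    finally show ?thesis ..
  qed
  have s: "(\<lambda>m. of_real (bessel_coeff \<mu> m) * z ^ m) sums bessel_series \<mu> z" if "\<mu> > -1" for \<mu>
    unfolding bessel_series_def using summable_bessel_series[OF that] by (rule summable_sums)
  have "(\<lambda>m. of_real (b m) * z ^ m) sums (of_real (\<nu> + 1) * bessel_series (\<nu> + 1) z - bessel_series \<nu> z)"
    using sums_diff[OF sums_mult[OF s[of "\<nu> + 1"], of "of_real (\<nu> + 1)"] s[of \<nu>]] \<nu>
    by (simp add: coeff algebra_simps)
  moreover have "(\<lambda>m. of_real (b m) * z ^ m) sums (z * bessel_series (\<nu> + 2) z)"
  proof -
    have "(\<lambda>m. of_real (b (Suc m)) * z ^ Suc m) sums (z * bessel_series (\<nu> + 2) z)"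
      using sums_mult[OF s[of "\<nu> + 2"], of z] \<nu> by (simp add: b_def mult_ac)
    then show ?thesis
      by (subst (asm) sums_Suc_iff) (simp add: b_def)
  qed
  ultimately show ?thesis
    using sums_unique2 by (fastforce simp: algebra_simps)
qed

text \<open>
On the negative axis all terms of the series are nonnegative, so each one is a lower bound. The
case \<open>n = 0\<close> excludes zeros there, and large \<open>n\<close> gives growth beyond every polynomial.
\<close>

lemma bessel_series_nonpos_lower_bound:
  fixes x :: real
  assumes \<nu>: "\<nu> > -1" and x: "x \<ge> 0"
  shows "bessel_series \<nu> (- x) \<ge> \<bar>bessel_coeff \<nu> n\<bar> * x ^ n"
proof -
  have eq: "bessel_coeff \<nu> m * (- x) ^ m = \<bar>bessel_coeff \<nu> m\<bar> * x ^ m" for m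
    using Gamma_shift_pos[OF \<nu>, of m] by (simp add: bessel_coeff_def abs_mult power_minus[of x])
  have "summable (\<lambda>m. \<bar>bessel_coeff \<nu> m\<bar> * x ^ m)"
    using summable_bessel_series[OF \<nu>, of "- x"] by (simp add: eq)
  then have "(\<Sum>m\<in>{n}. \<bar>bessel_coeff \<nu> m\<bar> * x ^ m) \<le> (\<Sum>m. \<bar>bessel_coeff \<nu> m\<bar> * x ^ m)"
    using x by (intro sum_le_suminf) auto
  then show ?thesis by (simp add: bessel_series_def eq)
qed

text \<open>
If two consecutive orders vanish at a nonzero point, the recurrence makes all higher orders vanish
there. These are, up to sign, all derivatives of the first one, which would then be zero.
\<close>

lemma bessel_series_zero_simple:
  assumes \<nu>: "\<nu> > -1" and a: "bessel_series \<nu> (a :: complex) = 0"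
  shows "bessel_series (\<nu> + 1) a \<noteq> 0"
proof
  assume a1: "bessel_series (\<nu> + 1) a = 0"
  have a0: "a \<noteq> 0"
    using a bessel_series_0_nonzero[OF \<nu>] by auto
  have all: "bessel_series (\<nu> + real n) a = 0 \<and> bessel_series (\<nu> + real n + 1) a = 0" for n
  proof (induction n)
    case 0
    then show ?case using a a1 by simp
  next
    case (Suc n)
    then show ?case
      using bessel_series_recurrence[of "\<nu> + real n" a] \<nu> a0 by (simp add: add_ac)
  qed
  have higher: "(deriv ^^ n) (bessel_series \<nu>) w = (-1) ^ n * bessel_series (\<nu> + real n) w" for n and w :: complex
  proof (induction n arbitrary: w)
    case (Suc n)
    then have "(deriv ^^ n) (bessel_series \<nu>) = (\<lambda>w :: complex. (-1) ^ n * bessel_series (\<nu> + real n) w)"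
      by blast
    moreover have "((\<lambda>w. (-1) ^ n * bessel_series (\<nu> + real n) w) has_field_derivative
                     (-1) ^ n * - bessel_series (\<nu> + real n + 1) w) (at w)"
      using \<nu> by (intro DERIV_cmult has_field_derivative_bessel_series) simp
    ultimately show ?case
      by (simp add: DERIV_imp_deriv add_ac)
  qed simp
  have "bessel_series \<nu> (0 :: complex) = 0"
    by (rule holomorphic_fun_eq_0_on_connected[of _ UNIV a])
       (use \<nu> all in \<open>auto simp: higher intro!: holomorphic_intros\<close>)
  then show False
    using bessel_series_0_nonzero[OF \<nu>] by blast
qed

section \<open>Zeros of the Bessel series\<close>

text \<open>
The self-adjointness argument for \<open>f t = F (a * t)\<close>, which satisfies
\<open>(t powr (\<nu> + 1) * f')' = - a * t powr \<nu> * f\<close>. Multiplying by \<open>cnj f\<close>, the imaginary part \<open>H\<close> of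
\<open>- t powr (\<nu> + 1) * f' * cnj f\<close> has derivative \<open>Im a * t powr \<nu> * (norm f)\<^sup>2\<close> and vanishes at both
ends of the unit interval. Rolle's theorem replaces the usual integration; it yields just one
point where \<open>Im a * f\<close> vanishes, whence the hypothesis that \<open>a\<close> is the first zero on its ray.
\<close>

lemma bessel_series_first_zero_on_ray_real:
  assumes \<nu>: "\<nu> > -1" and a: "bessel_series \<nu> a = 0"
    and seg: "\<And>t :: real. 0 < t \<Longrightarrow> t < 1 \<Longrightarrow> bessel_series \<nu> (a * of_real t) \<noteq> 0"
  shows "Im a = 0"
proof -
  let ?F = "\<lambda>\<mu> t. bessel_series \<mu> (a * complex_of_real t)"
  define q where "q = (\<lambda>t :: real. Im (a * ?F (\<nu> + 1) t * cnj (?F \<nu> t)))"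
  define H where "H = (\<lambda>t. t powr (\<nu> + 1) * q t)"
  have dF: "((\<lambda>t. ?F \<mu> t) has_vector_derivative - a * ?F (\<mu> + 1) t) (at t)" if "\<mu> > -1" for \<mu> t
  proof -
    have "((\<lambda>w. bessel_series \<mu> (a * w)) has_field_derivative - a * bessel_series (\<mu> + 1) (a * of_real t)) (at (of_real t))"
      using DERIV_chain2[OF has_field_derivative_bessel_series[OF that] DERIV_cmult_Id[of a], of "of_real t" UNIV]
      by (simp add: mult.commute)
    then show ?thesis
      by (rule has_vector_derivative_real_field)
  qed
  have dq: "(q has_real_derivative
       Im (a * (- a * ?F (\<nu> + 2) t) * cnj (?F \<nu> t) + a * ?F (\<nu> + 1) t * cnj (- a * ?F (\<nu> + 1) t))) (at t)" for t
  proof -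
    have "((\<lambda>t. a * ?F (\<nu> + 1) t * cnj (?F \<nu> t)) has_vector_derivative
            a * ?F (\<nu> + 1) t * cnj (- a * ?F (\<nu> + 1) t) + a * (- a * ?F (\<nu> + 1 + 1) t) * cnj (?F \<nu> t)) (at t)"
      using \<nu> by (intro has_vector_derivative_mult has_vector_derivative_mult_right has_vector_derivative_cnj dF) auto
    then have "(q has_vector_derivative
            Im (a * ?F (\<nu> + 1) t * cnj (- a * ?F (\<nu> + 1) t) + a * (- a * ?F (\<nu> + 1 + 1) t) * cnj (?F \<nu> t))) (at t)"
      unfolding q_def by (rule bounded_linear.has_vector_derivative[OF bounded_linear_Im])
    then show ?thesis
      by (simp add: has_real_derivative_iff_has_vector_derivative add_ac)
  qed
  have dH: "(H has_real_derivative Im a * (t powr \<nu> * (norm (?F \<nu> t))\<^sup>2)) (at t)" if t: "t > 0" for t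
  proof -
    have rec: "a * of_real t * ?F (\<nu> + 2) t = of_real (\<nu> + 1) * ?F (\<nu> + 1) t - ?F \<nu> t"
      using bessel_series_recurrence[OF \<nu>, of "a * of_real t"] by (simp add: algebra_simps)
    define X Y where "X = ?F \<nu> t" and "Y = ?F (\<nu> + 1) t"
    have "Im (a * (- a * ?F (\<nu> + 2) t) * cnj X + a * Y * cnj (- a * Y)) = Im (- a * (a * ?F (\<nu> + 2) t) * cnj X)"
      by (simp add: algebra_simps)
    also have "t * \<dots> = Im (- a * (a * of_real t * ?F (\<nu> + 2) t) * cnj X)"
      by (simp add: algebra_simps)
    also have "\<dots> = - (\<nu> + 1) * Im (a * Y * cnj X) + Im a * (norm X)\<^sup>2"
      unfolding rec X_def[symmetric] Y_def[symmetric] cmod_power2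
      by (simp add: algebra_simps power2_eq_square)
    finally have *: "t * Im (a * (- a * ?F (\<nu> + 2) t) * cnj X + a * Y * cnj (- a * Y))
        = - (\<nu> + 1) * q t + Im a * (norm X)\<^sup>2"
      by (simp add: q_def X_def Y_def)
    have "((\<lambda>t. t powr (\<nu> + 1)) has_real_derivative (\<nu> + 1) * t powr \<nu>) (at t)"
      using t by (auto intro!: derivative_eq_intros)
    then have "(H has_real_derivative (\<nu> + 1) * t powr \<nu> * q t +
        Im (a * (- a * ?F (\<nu> + 2) t) * cnj X + a * Y * cnj (- a * Y)) * t powr (\<nu> + 1)) (at t)"
      unfolding H_def X_def Y_def by (intro DERIV_mult dq)
    also have "(\<nu> + 1) * t powr \<nu> * q t +
        Im (a * (- a * ?F (\<nu> + 2) t) * cnj X + a * Y * cnj (- a * Y)) * t powr (\<nu> + 1)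
      = t powr \<nu> * ((\<nu> + 1) * q t + t * Im (a * (- a * ?F (\<nu> + 2) t) * cnj X + a * Y * cnj (- a * Y)))"
      using t by (simp add: powr_add algebra_simps)
    also have "\<dots> = Im a * (t powr \<nu> * (norm X)\<^sup>2)"
      unfolding * by (simp add: algebra_simps)
    finally show ?thesis by (simp add: X_def)
  qed
  have "continuous_on {0..1} q"
    using dq by (meson DERIV_isCont continuous_at_imp_continuous_on)
  then have cont: "continuous_on {0..1} H"
    unfolding H_def using \<nu> by (intro continuous_intros continuous_on_powr') auto
  have "H 0 = 0" "H 1 = 0"
    using \<nu> a by (auto simp: H_def q_def)
  then have "H 0 = H 1" by simp
  then obtain t where t: "0 < t" "t < 1" and
    eq: "(*) (Im a * (t powr \<nu> * (norm (?F \<nu> t))\<^sup>2)) = (\<lambda>v. 0)"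
    using Rolle_deriv[of 0 1 H "\<lambda>t. (*) (Im a * (t powr \<nu> * (norm (?F \<nu> t))\<^sup>2))", OF _ _ cont]
      dH[unfolded has_field_derivative_def] by auto
  from fun_cong[OF eq, of 1] have "Im a * (t powr \<nu> * (norm (?F \<nu> t))\<^sup>2) = 0" by simp
  then show ?thesis using seg[OF t] t by simp
qed

text \<open>
The first zero on the ray from the origin through \<open>a\<close> is real, and a positive real multiple of it
is \<open>a\<close>. Once \<open>a\<close> is real, it is positive because the series has no zero on the negative axis.
\<close>

lemma bessel_series_zeros_positive:
  assumes \<nu>: "\<nu> > -1" and a: "bessel_series \<nu> (a :: complex) = 0"
  shows "a \<in> \<real>" and "Re a > 0"
proof -
  let ?T = "{t :: real. bessel_series \<nu> (a * of_real t) = 0} \<inter> {0..1}"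
  note F0 = bessel_series_0_nonzero[OF \<nu>]
  have "continuous_on UNIV (\<lambda>t :: real. bessel_series \<nu> (a * of_real t))"
    by (intro continuous_on_compose2[OF holomorphic_on_imp_continuous_on[OF holomorphic_bessel_series[OF \<nu>, of UNIV]]]
              continuous_intros) auto
  then have "closed {t :: real. bessel_series \<nu> (a * of_real t) = 0}"
    by (intro closed_Collect_eq) auto
  then have "compact ?T"
    by (intro closed_Int_compact) auto
  moreover have "1 \<in> ?T" using a by simp
  ultimately obtain s where s: "s \<in> ?T" "\<And>t. t \<in> ?T \<Longrightarrow> s \<le> t"
    using compact_attains_inf[of ?T] by blast
  then have s0: "s > 0"
    using F0 by (cases "s = 0") auto
  have "Im (a * of_real s) = 0"
  proof (rule bessel_series_first_zero_on_ray_real[OF \<nu>])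
    show "bessel_series \<nu> (a * of_real s) = 0" using s by simp
    show "bessel_series \<nu> (a * of_real s * of_real t) \<noteq> 0" if t: "0 < t" "t < 1" for t
    proof
      assume "bessel_series \<nu> (a * of_real s * of_real t) = 0"
      then have "s * t \<in> ?T"
        using s(1) s0 t by (auto simp: mult.assoc mult_le_one)
      then have "s \<le> s * t" by (rule s(2))
      then show False using s0 t by (simp add: mult_le_cancel_left1)
    qed
  qed
  then have "Im a = 0" using s0 by simp
  then show real: "a \<in> \<real>" by (simp add: complex_is_Real_iff)
  show "Re a > 0"
  proof (rule ccontr)
    assume "\<not> Re a > 0"
    then have "bessel_series \<nu> (Re a) \<ge> \<bar>bessel_coeff \<nu> 0\<bar>"
      using bessel_series_nonpos_lower_bound[OF \<nu>, of "- Re a" 0] by simp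
    then have "bessel_series \<nu> (Re a) \<noteq> 0"
      using bessel_coeff_nonzero[OF \<nu>, of 0] by auto
    then show False
      using a real bessel_series_of_real[OF \<nu>, of "Re a"] by simp
  qed
qed

lemma bessel_series_log_deriv:
  fixes z :: complex
  assumes \<nu>: "\<nu> > -1" and z: "bessel_series \<nu> z \<noteq> 0"
  shows "((\<lambda>R. \<Sum>a | bessel_series \<nu> a = 0 \<and> norm a \<le> R. 1 / (a - z)) \<longlongrightarrow>
            bessel_series (\<nu> + 1) z / bessel_series \<nu> z) at_top"
    and "((\<lambda>R. \<Sum>a | bessel_series \<nu> a = 0 \<and> norm a \<le> R. 1 / (a - z)\<^sup>2) \<longlongrightarrow>
            ((bessel_series (\<nu> + 1) z)\<^sup>2 - bessel_series \<nu> z * bessel_series (\<nu> + 2) z)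
              / (bessel_series \<nu> z)\<^sup>2) at_top"
proof -
  let ?F = "bessel_series \<nu> :: complex \<Rightarrow> complex"
  have hol: "?F holomorphic_on UNIV" by (intro holomorphic_intros \<nu>)
  have type: "\<exists>K. \<forall>z. norm (?F z) \<le> K * exp (\<epsilon> * norm z)" if "\<epsilon> > 0" for \<epsilon>
    using bessel_coeff_exp_bound[OF \<nu> that] bessel_series_exp_bound(2) by metis
  have simple: "deriv ?F a \<noteq> 0" if "?F a = 0" for a
    using bessel_series_zero_simple[OF \<nu> that] \<nu> by (simp add: deriv_bessel_series)
  note lims = log_deriv_expansion[OF hol bessel_series_0_nonzero[OF \<nu>] simple type z]
  show "((\<lambda>R. \<Sum>a | ?F a = 0 \<and> norm a \<le> R. 1 / (a - z)) \<longlongrightarrow>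
            bessel_series (\<nu> + 1) z / ?F z) at_top"
    using lims(1) \<nu> by (simp add: deriv_bessel_series)
  show "((\<lambda>R. \<Sum>a | ?F a = 0 \<and> norm a \<le> R. 1 / (a - z)\<^sup>2) \<longlongrightarrow>
            ((bessel_series (\<nu> + 1) z)\<^sup>2 - ?F z * bessel_series (\<nu> + 2) z) / (?F z)\<^sup>2) at_top"
    using lims(2) \<nu> by (simp add: deriv_bessel_series deriv_deriv_bessel_series)
qed

text \<open>
With finitely many zeros, \<open>F\<close> and the polynomial \<open>P\<close> of its zeros would have the same logarithmic
derivative, so \<open>F\<close> would be a multiple of \<open>P\<close> on the left half plane. This contradicts the growth
of \<open>F\<close> along the negative axis.
\<close>

lemma infinite_bessel_series_zeros:
  assumes \<nu>: "\<nu> > -1"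
  shows "infinite {a :: complex. bessel_series \<nu> a = 0}"
proof
  let ?F = "bessel_series \<nu> :: complex \<Rightarrow> complex"
  define Z where "Z = {a. ?F a = 0}"
  assume fin: "finite {a. ?F a = 0}"
  then have finZ: "finite Z" by (simp add: Z_def)
  have hol: "?F holomorphic_on UNIV" by (intro holomorphic_intros \<nu>)
  obtain B where B: "\<And>a. a \<in> Z \<Longrightarrow> norm a \<le> B"
    using finite_imp_bounded[OF finZ] by (auto simp: bounded_iff)
  have ld: "deriv ?F z / ?F z = - (\<Sum>a\<in>Z. 1 / (a - z))" if "?F z \<noteq> 0" for z
  proof -
    have "\<forall>\<^sub>F R in at_top. (\<Sum>a | ?F a = 0 \<and> norm a \<le> R. 1 / (a - z)) = (\<Sum>a\<in>Z. 1 / (a - z))"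
      using eventually_ge_at_top[of B]
    proof eventually_elim
      case (elim R)
      then have "{a. ?F a = 0 \<and> norm a \<le> R} = Z"
        using B by (force simp: Z_def)
      then show ?case by simp
    qed
    moreover have "((\<lambda>R. \<Sum>a | ?F a = 0 \<and> norm a \<le> R. 1 / (a - z)) \<longlongrightarrow> - deriv ?F z / ?F z) at_top"
      using bessel_series_log_deriv(1)[OF \<nu> that] \<nu> by (simp add: deriv_bessel_series)
    ultimately have "((\<lambda>R. \<Sum>a\<in>Z. 1 / (a - z)) \<longlongrightarrow> - deriv ?F z / ?F z) (at_top :: real filter)"
      using tendsto_cong by fastforce
    then have "(\<Sum>a\<in>Z. 1 / (a - z)) = - deriv ?F z / ?F z"
      by (simp add: tendsto_const_iff)
    then show ?thesis by simp
  qed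
  define P where "P = (\<lambda>z :: complex. \<Prod>a\<in>Z. a - z)"
  have Z_pos: "Re a > 0" if "a \<in> Z" for a
    using bessel_series_zeros_positive[OF \<nu>] that by (simp add: Z_def)
  have "\<exists>c. \<forall>z\<in>{z. Re z < 0}. ?F z / P z = c"
  proof (rule has_field_derivative_zero_constant)
    show "convex {z. Re z < 0}" by (rule convex_halfspace_Re_lt)
    fix z assume "z \<in> {z. Re z < 0}"
    then have z: "Re z < 0" by simp
    have zZ: "a - z \<noteq> 0" if "a \<in> Z" for a
      using Z_pos[OF that] z by auto
    then have Fz: "?F z \<noteq> 0" and Pz: "P z \<noteq> 0"
      using finZ by (auto simp: Z_def P_def)
    have "(P has_field_derivative P z * (\<Sum>a\<in>Z. -1 / (a - z))) (at z)"
      unfolding P_def using zZ by (intro has_field_derivative_prod') (auto intro!: derivative_eq_intros)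
    moreover have "(\<Sum>a\<in>Z. -1 / (a - z)) = deriv ?F z / ?F z"
      by (simp add: ld[OF Fz] sum_negf[symmetric])
    ultimately have dP: "(P has_field_derivative P z * (deriv ?F z / ?F z)) (at z)"
      by simp
    have dF: "(?F has_field_derivative deriv ?F z) (at z)"
      using hol by (auto intro: holomorphic_derivI)
    have "((\<lambda>z. ?F z / P z) has_field_derivative 0) (at z)"
      using DERIV_divide[OF dF dP Pz] Fz by simp
    then show "((\<lambda>z. ?F z / P z) has_field_derivative 0) (at z within {z. Re z < 0})"
      by (rule has_field_derivative_at_within)
  qed
  then obtain c where c: "\<And>z. Re z < 0 \<Longrightarrow> ?F z / P z = c" by blast
  define n where "n = card Z"
  define C where "C = norm c * (\<Prod>a\<in>Z. norm a + 1)"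
  define k where "k = \<bar>bessel_coeff \<nu> (Suc n)\<bar>"
  have k: "k > 0" using bessel_coeff_nonzero[OF \<nu>] by (simp add: k_def)
  have bound: "k * x \<le> C" if x: "x \<ge> 1" for x
  proof -
    have "a - - of_real x \<noteq> 0" if "a \<in> Z" for a
      using Z_pos[OF that] x by (auto simp: complex_eq_iff)
    then have P0: "P (- of_real x) \<noteq> 0"
      using finZ by (simp add: P_def)
    have "norm (P (- of_real x)) \<le> (\<Prod>a\<in>Z. (norm a + 1) * x)"
      unfolding P_def prod_norm[symmetric]
    proof (rule prod_mono, safe)
      fix a :: complex
      have "norm (a - - of_real x) \<le> norm a + x"
        using norm_triangle_ineq[of a "of_real x"] x by simp
      also have "\<dots> \<le> norm a * x + 1 * x"
        using x by (intro add_mono) (auto simp: mult_le_cancel_left1)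
      finally show "norm (a - - of_real x) \<le> (norm a + 1) * x"
        by (simp add: algebra_simps)
    qed auto
    also have "\<dots> = (\<Prod>a\<in>Z. norm a + 1) * x ^ n"
      by (simp add: prod.distrib n_def)
    finally have P_le: "norm (P (- of_real x)) \<le> (\<Prod>a\<in>Z. norm a + 1) * x ^ n" .
    have "k * x ^ Suc n \<le> bessel_series \<nu> (- x)"
      unfolding k_def using x by (intro bessel_series_nonpos_lower_bound \<nu>) auto
    also have "\<dots> \<le> norm (?F (- of_real x))"
      using bessel_series_of_real[OF \<nu>, of "- x"] by simp
    also have "\<dots> = norm c * norm (P (- of_real x))"
      using c[of "- of_real x"] x P0 by (simp add: divide_simps norm_mult[symmetric])
    also have "\<dots> \<le> norm c * ((\<Prod>a\<in>Z. norm a + 1) * x ^ n)"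
      by (rule mult_left_mono[OF P_le]) simp
    finally have "k * x * x ^ n \<le> C * x ^ n"
      by (simp add: C_def mult_ac)
    then show ?thesis using x by simp
  qed
  have "k * (C / k + 1) \<le> C"
    using k by (intro bound) (auto simp: C_def intro!: prod_nonneg divide_nonneg_pos mult_nonneg_nonneg)
  moreover have "k * (C / k + 1) = C + k"
    using k by (simp add: distrib_left)
  ultimately show False using k by simp
qed

section \<open>Enumerating zeros and summing over them\<close>

text \<open>
For a locally finite infinite set of positive zeros the counting function is a bijection onto the
positive integers, and \<open>pos_zero\<close> is its inverse.
\<close>

lemma pos_zero_bij_betw:
  fixes f :: "real \<Rightarrow> real"
  defines "S \<equiv> {x. 0 < x \<and> f x = 0}"
  assumes inf: "infinite S" and fin: "\<And>x. finite (S \<inter> {..x})"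
  shows "bij_betw (pos_zero f) {1..} S"
proof -
  define N where "N = (\<lambda>x. card (S \<inter> {..x}))"
  have N_eq: "card {y. 0 < y \<and> y \<le> x \<and> f y = 0} = N x" for x
    unfolding N_def by (rule arg_cong[of _ _ card]) (auto simp: S_def)
  have ex: "\<exists>x\<ge>0. N x = n \<and> (n > 0 \<longrightarrow> x \<in> S)" for n
  proof (induction n)
    \<comment> \<open>Counting starts at the origin, which is itself not a zero.\<close>
    case 0
    have "S \<inter> {..0} = {}" by (auto simp: S_def)
    then show ?case by (intro exI[of _ 0]) (simp add: N_def)
  next
    case (Suc n)
    then obtain x where x: "x \<ge> 0" "N x = n" by blast
    have "\<not> S \<subseteq> S \<inter> {..x}"
      using inf fin finite_subset by blast
    then obtain y where y: "y \<in> S" "y > x" by force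
    define T where "T = S \<inter> {x<..y}"
    have T: "finite T" "T \<noteq> {}"
      using y by (auto simp: T_def intro: finite_subset[OF _ fin[of y]])
    define x' where "x' = Min T"
    have x': "x' \<in> T" "\<And>t. t \<in> T \<Longrightarrow> x' \<le> t"
      using T by (auto simp: x'_def)
    have "S \<inter> {..x'} = insert x' (S \<inter> {..x})"
    proof (intro equalityI subsetI)
      fix t assume t: "t \<in> S \<inter> {..x'}"
      show "t \<in> insert x' (S \<inter> {..x})"
      proof (cases "t \<le> x")
        case False
        then have "t \<in> T" using t x'(1) by (auto simp: T_def)
        then show ?thesis using x'(2)[of t] t by auto
      qed (use t in auto)
    qed (use x' in \<open>auto simp: T_def\<close>)
    moreover have "x' \<notin> S \<inter> {..x}" using x' by (auto simp: T_def)
    ultimately have "N x' = Suc n"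
      using fin x by (simp add: N_def)
    then show ?case using x' x by (intro exI[of _ x']) (auto simp: T_def)
  qed
  have less: "N x < N y" if "x < y" "y \<in> S" for x y
  proof -
    have "y \<in> S \<inter> {..y}" "y \<notin> S \<inter> {..x}" using that by auto
    moreover have "S \<inter> {..x} \<subseteq> S \<inter> {..y}" using that by auto
    ultimately have "S \<inter> {..x} \<subset> S \<inter> {..y}" by blast
    then show ?thesis
      unfolding N_def by (intro psubset_card_mono fin)
  qed
  have uniq: "x = y" if "x \<in> S" "y \<in> S" "N x = N y" for x y
    using less[of x y] less[of y x] that by (cases x y rule: linorder_cases) auto
  have pz: "pos_zero f n \<in> S \<and> N (pos_zero f n) = n" if n: "n \<ge> 1" for n
  proof -
    have "\<exists>!x. x \<in> S \<and> N x = n"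
      using ex[of n] n uniq by (metis less_le_trans zero_less_one)
    moreover have "pos_zero f n = (THE x. x \<in> S \<and> N x = n)"
      unfolding pos_zero_def N_eq by (simp add: S_def)
    ultimately show ?thesis
      using theI'[of "\<lambda>x. x \<in> S \<and> N x = n"] by simp
  qed
  have "N x \<ge> 1" if "x \<in> S" for x
    using less[of 0 x] that by (auto simp: S_def)
  then have "x \<in> pos_zero f ` {1..}" if "x \<in> S" for x
    using that pz[of "N x"] uniq[of x "pos_zero f (N x)"] by (intro image_eqI[of _ _ "N x"]) auto
  moreover have "inj_on (pos_zero f) {1..}"
    using pz by (intro inj_onI) (metis atLeast_iff)
  ultimately show ?thesis
    using pz by (auto simp: bij_betw_def)
qed

text \<open>
For nonnegative terms, a limit along one exhausting family of finite sets is already the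
unconditional sum. This is what upgrades the limits along discs.
\<close>

lemma has_sum_nonneg_exhaustion:
  fixes g :: "'a \<Rightarrow> real"
  assumes nonneg: "\<And>a. a \<in> A \<Longrightarrow> g a \<ge> 0"
    and fin: "\<And>R :: real. finite (T R)" and mono: "\<And>R R'. R \<le> R' \<Longrightarrow> T R \<subseteq> T R'"
    and exh: "(\<Union>R. T R) = A"
    and lim: "((\<lambda>R. sum g (T R)) \<longlongrightarrow> L) at_top"
  shows "(g has_sum L) A"
proof -
  have le: "sum g (T R) \<le> L" for R
  proof (rule tendsto_lowerbound[OF lim])
    show "\<forall>\<^sub>F R' in at_top. sum g (T R) \<le> sum g (T R')"
      using eventually_ge_at_top[of R]
    proof eventually_elim
      case (elim R')
      show ?case
        using mono[OF elim] fin nonneg exh by (intro sum_mono2) blast+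
    qed
  qed simp
  have sub: "\<exists>R. X \<subseteq> T R" if "finite X" "X \<subseteq> A" for X
    using that
  proof (induction X)
    case (insert x X)
    then obtain R R' where "X \<subseteq> T R" "x \<in> T R'" using exh by auto
    then have "insert x X \<subseteq> T (max R R')"
      using mono[of R "max R R'"] mono[of R' "max R R'"] by auto
    then show ?case ..
  qed auto
  have le': "sum g X \<le> L" if X: "finite X" "X \<subseteq> A" for X
  proof -
    obtain R where R: "X \<subseteq> T R" using sub[OF X] by blast
    have "sum g X \<le> sum g (T R)"
      using R fin nonneg exh by (intro sum_mono2) blast+
    also note le
    finally show ?thesis .
  qed
  show ?thesis
    unfolding has_sum_def
  proof (rule order_tendstoI)
    fix b assume "b < L"
    then obtain R where R: "b < sum g (T R)"
      using order_tendstoD(1)[OF lim] by (metis eventually_happens trivial_limit_at_top_linorder)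
    show "\<forall>\<^sub>F X in finite_subsets_at_top A. b < sum g X"
      unfolding eventually_finite_subsets_at_top
    proof (intro exI[of _ "T R"] conjI allI impI)
      fix X assume X: "finite X \<and> T R \<subseteq> X \<and> X \<subseteq> A"
      then have "sum g (T R) \<le> sum g X"
        using nonneg by (intro sum_mono2) blast+
      with R show "b < sum g X" by simp
    qed (use fin exh in auto)
  next
    fix b assume "b > L"
    then show "\<forall>\<^sub>F X in finite_subsets_at_top A. b > sum g X"
      using le' by (intro eventually_finite_subsets_at_top_weakI) (meson le_less_trans)
  qed
qed

section \<open>Positive zeros of the Bessel function and of its derivative\<close>

lemma bessel_J_eq_series:
  assumes "\<nu> > -1" and x: "x > 0"
  shows "bessel_J \<nu> x = (x / 2) powr \<nu> * bessel_series \<nu> (x\<^sup>2 / 4)"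
proof -
  have "(x / 2) powr (2 * real m + \<nu>) = (x / 2) powr \<nu> * (x\<^sup>2 / 4) ^ m" for m
  proof -
    have "(x / 2) powr (2 * real m) = ((x / 2)\<^sup>2) ^ m"
      using x powr_realpow[of "x / 2" "2 * m"] by (simp add: power_mult)
    then show ?thesis by (simp add: powr_add power_divide)
  qed
  then have "bessel_J \<nu> x = (\<Sum>m. (x / 2) powr \<nu> * (bessel_coeff \<nu> m * (x\<^sup>2 / 4) ^ m))"
    by (simp add: bessel_J_def bessel_coeff_def mult_ac)
  also have "\<dots> = (x / 2) powr \<nu> * bessel_series \<nu> (x\<^sup>2 / 4)"
    using suminf_mult[OF summable_bessel_series[OF assms(1), of "x\<^sup>2 / 4"]] by (simp add: bessel_series_def)
  finally show ?thesis .
qed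

lemma has_real_derivative_bessel_J:
  assumes \<nu>: "\<nu> > -1" and x: "x > 0"
  shows "(bessel_J \<nu> has_real_derivative
    (x / 2) powr \<nu> / x * (\<nu> * bessel_series \<nu> (x\<^sup>2 / 4) - x\<^sup>2 / 2 * bessel_series (\<nu> + 1) (x\<^sup>2 / 4))) (at x)"
proof -
  have "((\<lambda>x. bessel_series \<nu> (x\<^sup>2 / 4)) has_real_derivative - bessel_series (\<nu> + 1) (x\<^sup>2 / 4) * (x / 2)) (at x)"
    by (rule DERIV_chain2[OF has_field_derivative_bessel_series[OF \<nu>]]) (auto intro!: derivative_eq_intros)
  moreover have "((\<lambda>x. (x / 2) powr \<nu>) has_real_derivative \<nu> / x * (x / 2) powr \<nu>) (at x)"
    using x by (auto intro!: derivative_eq_intros simp: powr_diff)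
  ultimately have "((\<lambda>x. (x / 2) powr \<nu> * bessel_series \<nu> (x\<^sup>2 / 4)) has_real_derivative
     \<nu> / x * (x / 2) powr \<nu> * bessel_series \<nu> (x\<^sup>2 / 4)
     + - bessel_series (\<nu> + 1) (x\<^sup>2 / 4) * (x / 2) * (x / 2) powr \<nu>) (at x)"
    by (rule DERIV_mult[rotated])
  also have "\<nu> / x * (x / 2) powr \<nu> * bessel_series \<nu> (x\<^sup>2 / 4)
     + - bessel_series (\<nu> + 1) (x\<^sup>2 / 4) * (x / 2) * (x / 2) powr \<nu>
    = (x / 2) powr \<nu> / x * (\<nu> * bessel_series \<nu> (x\<^sup>2 / 4) - x\<^sup>2 / 2 * bessel_series (\<nu> + 1) (x\<^sup>2 / 4))"
    using x by (simp add: divide_simps power2_eq_square) (simp add: algebra_simps)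
  finally show ?thesis
    by (rule has_field_derivative_transform_within_open[of _ _ _ "{0<..}"])
       (use x \<nu> in \<open>auto simp: bessel_J_eq_series\<close>)
qed

lemma bessel_J_zero_iff:
  assumes "\<nu> > -1" "x > 0"
  shows "bessel_J \<nu> x = 0 \<longleftrightarrow> bessel_series \<nu> (complex_of_real (x\<^sup>2 / 4)) = 0"
  using assms by (simp add: bessel_J_eq_series bessel_series_of_real del: of_real_divide of_real_power)

lemma deriv_bessel_J_zero_iff:
  assumes "\<nu> > -1" "x > 0"
  shows "deriv (bessel_J \<nu>) x = 0 \<longleftrightarrow>
    \<nu> * bessel_series \<nu> (complex_of_real (x\<^sup>2 / 4)) =
      2 * complex_of_real (x\<^sup>2 / 4) * bessel_series (\<nu> + 1) (complex_of_real (x\<^sup>2 / 4))"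
proof -
  have "deriv (bessel_J \<nu>) x = 0 \<longleftrightarrow>
      \<nu> * bessel_series \<nu> (x\<^sup>2 / 4) = 2 * (x\<^sup>2 / 4) * bessel_series (\<nu> + 1) (x\<^sup>2 / 4)"
    using DERIV_imp_deriv[OF has_real_derivative_bessel_J[OF assms]] assms by simp
  also have "\<dots> \<longleftrightarrow> complex_of_real (\<nu> * bessel_series \<nu> (x\<^sup>2 / 4)) =
      complex_of_real (2 * (x\<^sup>2 / 4) * bessel_series (\<nu> + 1) (x\<^sup>2 / 4))"
    unfolding of_real_eq_iff ..
  finally show ?thesis
    using assms by (simp only: bessel_series_of_real of_real_mult of_real_numeral)
qed

lemma finite_zeros_square_quarter:
  fixes E :: "complex \<Rightarrow> complex"
  assumes "E holomorphic_on UNIV" and "E w \<noteq> 0"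
  shows "finite {y. 0 < y \<and> y \<le> x \<and> E (complex_of_real (y\<^sup>2 / 4)) = 0}" (is "finite ?Y")
proof (rule finite_imageD)
  let ?q = "\<lambda>y. complex_of_real (y\<^sup>2 / 4)"
  have "?q ` ?Y \<subseteq> {a. E a = 0 \<and> norm a \<le> x\<^sup>2 / 4}"
    by (auto simp: norm_divide norm_power power_mono)
  then show "finite (?q ` ?Y)"
    using finite_zeros_cball[OF assms] by (rule finite_subset)
  show "inj_on ?q ?Y"
    by (rule inj_onI) (auto simp del: of_real_divide of_real_power)
qed

lemma bessel_J_zeros:
  assumes \<nu>: "\<nu> > -1"
  defines "S \<equiv> {x. 0 < x \<and> bessel_J \<nu> x = 0}"
  shows "bij_betw (\<lambda>x. complex_of_real (x\<^sup>2 / 4)) S {a. bessel_series \<nu> a = 0}"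
    and "infinite S" and "finite (S \<inter> {..x})"
proof -
  let ?q = "\<lambda>x. complex_of_real (x\<^sup>2 / 4)"
  show bij: "bij_betw ?q S {a. bessel_series \<nu> a = 0}"
  proof (rule bij_betw_imageI)
    show "inj_on ?q S"
      by (rule inj_onI) (auto simp: S_def simp del: of_real_divide of_real_power)
    show "?q ` S = {a. bessel_series \<nu> a = 0}"
    proof (intro equalityI subsetI)
      fix a :: complex assume "a \<in> ?q ` S"
      then show "a \<in> {a. bessel_series \<nu> a = 0}"
        using bessel_J_zero_iff[OF \<nu>] by (auto simp: S_def simp del: of_real_divide of_real_power)
    next
      fix a :: complex assume a: "a \<in> {a. bessel_series \<nu> a = 0}"
      then have pos: "Re a > 0" and "a \<in> \<real>"
        using bessel_series_zeros_positive[OF \<nu>, of a] by auto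
      then have q: "a = ?q (2 * sqrt (Re a))"
        by (simp add: power_mult_distrib)
      then have "2 * sqrt (Re a) \<in> S"
        using a pos bessel_J_zero_iff[OF \<nu>, of "2 * sqrt (Re a)"] by (simp add: S_def)
      with q show "a \<in> ?q ` S" by blast
    qed
  qed
  show "infinite S"
    using bij_betw_finite[OF bij] infinite_bessel_series_zeros[OF \<nu>] by simp
  have "S \<inter> {..x} = {y. 0 < y \<and> y \<le> x \<and> bessel_series \<nu> (?q y) = 0}"
    using bessel_J_zero_iff[OF \<nu>] by (auto simp: S_def simp del: of_real_divide of_real_power)
  then show "finite (S \<inter> {..x})"
    using finite_zeros_square_quarter[OF holomorphic_bessel_series[OF \<nu>] bessel_series_0_nonzero[OF \<nu>]] by simp
qed

text \<open>
Rolle's theorem gives zeros of the derivative beyond every bound. They are isolated because they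
correspond to zeros of the entire function \<open>E = \<nu> * F + 2 * z * F'\<close>, which is not identically zero:
it does not vanish at the zeros of \<open>F\<close>, as these are simple.
\<close>

lemma deriv_bessel_J_zeros:
  assumes \<nu>: "\<nu> > -1"
  defines "S \<equiv> {x. 0 < x \<and> deriv (bessel_J \<nu>) x = 0}"
  shows "infinite S" and "finite (S \<inter> {..x})"
proof -
  let ?J = "{x. 0 < x \<and> bessel_J \<nu> x = 0}"
  have larger: "\<exists>y\<in>?J. y > M" for M
  proof -
    have "\<not> ?J \<subseteq> ?J \<inter> {..M}"
      using bessel_J_zeros[OF \<nu>] finite_subset by blast
    then show ?thesis by force
  qed
  show "infinite S"
  proof
    assume "finite S"
    then obtain M where M: "\<And>c. c \<in> S \<Longrightarrow> c \<le> M"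
      using bdd_above_finite[of S] unfolding bdd_above_def by blast
    obtain y y' where y: "y \<in> ?J" "M < y" "y' \<in> ?J" "y < y'"
      using larger by blast
    have diff: "bessel_J \<nu> differentiable (at t)" if "t \<ge> y" for t
      using has_real_derivative_bessel_J[OF \<nu>, of t] y that real_differentiable_def by fastforce
    have "\<exists>c. y < c \<and> c < y' \<and> (bessel_J \<nu> has_real_derivative 0) (at c)"
    proof (rule Rolle)
      show "continuous_on {y..y'} (bessel_J \<nu>)"
        using diff by (auto intro!: continuous_at_imp_continuous_on differentiable_imp_continuous_within)
    qed (use y diff in auto)
    then obtain c where "y < c" "deriv (bessel_J \<nu>) c = 0"
      by (auto dest: DERIV_imp_deriv)
    then have "c \<in> S" using y by (simp add: S_def)
    with M[of c] \<open>y < c\<close> y show False by simp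
  qed
  define E :: "complex \<Rightarrow> complex"
    where "E = (\<lambda>z. of_real \<nu> * bessel_series \<nu> z - 2 * z * bessel_series (\<nu> + 1) z)"
  obtain a :: complex where a: "bessel_series \<nu> a = 0"
    using infinite_imp_nonempty[OF infinite_bessel_series_zeros[OF \<nu>]] by auto
  have "a \<noteq> 0"
    using bessel_series_zeros_positive(2)[OF \<nu> a] by auto
  then have "E a \<noteq> 0"
    using bessel_series_zero_simple[OF \<nu> a] a by (simp add: E_def)
  moreover have "E holomorphic_on UNIV"
    unfolding E_def using \<nu> by (intro holomorphic_intros) auto
  moreover have "S \<inter> {..x} = {y. 0 < y \<and> y \<le> x \<and> E (complex_of_real (y\<^sup>2 / 4)) = 0}"
  proof -
    have E_iff: "deriv (bessel_J \<nu>) y = 0 \<longleftrightarrow> E (complex_of_real (y\<^sup>2 / 4)) = 0" if "y > 0" for y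
      unfolding E_def right_minus_eq by (rule deriv_bessel_J_zero_iff[OF \<nu> that])
    show ?thesis
      unfolding S_def using E_iff by blast
  qed
  ultimately show "finite (S \<inter> {..x})"
    using finite_zeros_square_quarter[of E a] by simp
qed

section \<open>Summation at a critical point\<close>

text \<open>
Since \<open>a / (a - z)\<^sup>2 = 1 / (a - z) + z / (a - z)\<^sup>2\<close>, the sum is a combination of the first two
logarithmic derivatives of \<open>F\<close> at \<open>z\<close>. The hypothesis \<open>crit\<close> fixes \<open>F' / F\<close> there as
\<open>- \<nu> / (2 * z)\<close>, and the differential equation then determines \<open>F'' / F\<close>.
\<close>

lemma bessel_series_zero_sum:
  assumes \<nu>: "\<nu> > -1" and z: "z > 0"
    and crit: "\<nu> * bessel_series \<nu> (complex_of_real z) = 2 * complex_of_real z * bessel_series (\<nu> + 1) (complex_of_real z)"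
  shows "((\<lambda>a. Re a / (Re a - z)\<^sup>2) has_sum (1 - \<nu>\<^sup>2 / (4 * z))) {a. bessel_series \<nu> a = 0}"
proof -
  let ?F = "bessel_series \<nu> :: complex \<Rightarrow> complex"
  let ?z = "complex_of_real z"
  let ?g = "\<lambda>a. Re a / (Re a - z)\<^sup>2"
  let ?T = "\<lambda>R. {a. ?F a = 0 \<and> norm a \<le> R}"
  define X Y where "X = ?F ?z" and "Y = bessel_series (\<nu> + 1) ?z"
  have X: "X \<noteq> 0"
    using crit bessel_series_zero_simple[OF \<nu>, of ?z] z by (auto simp: X_def)
  let ?L = "Y / X + ?z * ((Y\<^sup>2 - X * bessel_series (\<nu> + 2) ?z) / X\<^sup>2)"
  have lim_complex: "((\<lambda>R. (\<Sum>a\<in>?T R. 1 / (a - ?z)) + ?z * (\<Sum>a\<in>?T R. 1 / (a - ?z)\<^sup>2)) \<longlongrightarrow> ?L) at_top"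
    using X unfolding X_def Y_def
    by (intro tendsto_add tendsto_mult tendsto_const bessel_series_log_deriv \<nu>)
  have sums: "(\<Sum>a\<in>?T R. 1 / (a - ?z)) + ?z * (\<Sum>a\<in>?T R. 1 / (a - ?z)\<^sup>2) = of_real (\<Sum>a\<in>?T R. ?g a)" for R
    unfolding sum_distrib_left sum.distrib[symmetric] of_real_sum
  proof (rule sum.cong[OF refl])
    fix a assume a: "a \<in> ?T R"
    then have ne: "a \<noteq> ?z" using X by (auto simp: X_def)
    have "a \<in> \<real>" using a bessel_series_zeros_positive(1)[OF \<nu>, of a] by simp
    then have re: "a = of_real (Re a)" by simp
    have "1 / (a - ?z) + ?z * (1 / (a - ?z)\<^sup>2) = a / (a - ?z)\<^sup>2"
      using ne by (simp add: divide_simps power2_eq_square)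
    also have "\<dots> = of_real (?g a)"
      by (subst (1 2) re) simp
    finally show "1 / (a - ?z) + ?z * (1 / (a - ?z)\<^sup>2) = of_real (?g a)" .
  qed
  have L: "?L = of_real (1 - \<nu>\<^sup>2 / (4 * z))"
  proof -
    have rec: "?z * bessel_series (\<nu> + 2) ?z = (\<nu> + 1) * Y - X"
      using bessel_series_recurrence[OF \<nu>, of ?z] by (simp add: X_def Y_def algebra_simps)
    have Y: "Y = X * (\<nu> / (2 * ?z))"
      using crit z by (simp add: X_def Y_def field_simps)
    have "?L = Y / X + (?z * Y\<^sup>2 - X * (?z * bessel_series (\<nu> + 2) ?z)) / X\<^sup>2"
      by (simp add: algebra_simps)
    also have "\<dots> = 1 - \<nu>\<^sup>2 / (4 * ?z)"
      unfolding rec Y using X z by (simp add: divide_simps power2_eq_square) (simp add: algebra_simps)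
    finally show ?thesis by simp
  qed
  have lim: "((\<lambda>R. \<Sum>a\<in>?T R. ?g a) \<longlongrightarrow> 1 - \<nu>\<^sup>2 / (4 * z)) at_top"
    using lim_complex unfolding sums L tendsto_of_real_iff .
  show ?thesis
  proof (rule has_sum_nonneg_exhaustion[OF _ _ _ _ lim])
    show "?g a \<ge> 0" if "a \<in> {a. ?F a = 0}" for a
      using bessel_series_zeros_positive(2)[OF \<nu>, of a] that by simp
    show "finite (?T R)" for R
      by (rule finite_zeros_cball[OF holomorphic_bessel_series bessel_series_0_nonzero]) (fact \<nu>)+
  qed auto
qed

theorem mainTheorem6:
  fixes \<nu> :: real and n :: nat
  assumes "\<nu> > -1" and "n \<ge> 1"
  shows "((\<lambda>k. (bessel_J_zero \<nu> k)\<^sup>2 /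
              ((bessel_J_deriv_zero \<nu> n)\<^sup>2 - (bessel_J_zero \<nu> k)\<^sup>2)\<^sup>2)
          has_sum (1 / 4 - \<nu>\<^sup>2 / (4 * (bessel_J_deriv_zero \<nu> n)\<^sup>2))) {1..}"
proof -
  define x where "x = bessel_J_deriv_zero \<nu> n"
  define z where "z = x\<^sup>2 / 4"
  have "bij_betw (pos_zero (deriv (bessel_J \<nu>))) {1..} {x. 0 < x \<and> deriv (bessel_J \<nu>) x = 0}"
    by (intro pos_zero_bij_betw deriv_bessel_J_zeros assms)
  then have x: "x > 0" "deriv (bessel_J \<nu>) x = 0"
    using assms(2) by (auto simp: x_def bessel_J_deriv_zero_def dest: bij_betwE)
  have z: "z > 0" using x by (simp add: z_def)
  have sum: "((\<lambda>a. Re a / (Re a - z)\<^sup>2) has_sum (1 - \<nu>\<^sup>2 / (4 * z))) {a. bessel_series \<nu> a = 0}"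
    using assms(1) z deriv_bessel_J_zero_iff[OF assms(1) x(1)] x(2)
    unfolding z_def[symmetric] by (intro bessel_series_zero_sum) auto
  have "bij_betw (bessel_J_zero \<nu>) {1..} {x. 0 < x \<and> bessel_J \<nu> x = 0}"
    unfolding bessel_J_zero_def by (intro pos_zero_bij_betw bessel_J_zeros assms)
  from bij_betw_trans[OF this bessel_J_zeros(1)[OF assms(1)]]
  have bij: "bij_betw (\<lambda>k. complex_of_real ((bessel_J_zero \<nu> k)\<^sup>2 / 4)) {1..} {a. bessel_series \<nu> a = 0}"
    by (simp add: o_def)
  have "((\<lambda>k. (bessel_J_zero \<nu> k)\<^sup>2 / 4 / ((bessel_J_zero \<nu> k)\<^sup>2 / 4 - z)\<^sup>2) has_sum (1 - \<nu>\<^sup>2 / (4 * z))) {1..}"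
    using sum unfolding has_sum_reindex_bij_betw[OF bij, symmetric] Re_complex_of_real .
  from has_sum_cmult_right[OF this, of "1 / 4"]
  have "((\<lambda>k. 1 / 4 * ((bessel_J_zero \<nu> k)\<^sup>2 / 4 / ((bessel_J_zero \<nu> k)\<^sup>2 / 4 - z)\<^sup>2)) has_sum
          (1 / 4 - \<nu>\<^sup>2 / (4 * x\<^sup>2))) {1..}"
    by (simp add: z_def algebra_simps)
  moreover have "1 / 4 * (j / 4 / (j / 4 - z)\<^sup>2) = j / (x\<^sup>2 - j)\<^sup>2" for j
  proof -
    have "(j / 4 - z)\<^sup>2 = (x\<^sup>2 - j)\<^sup>2 / 16"
      by (simp add: z_def power2_eq_square algebra_simps)
    then show ?thesis by simp
  qed
  ultimately show ?thesis by (simp only: x_def)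
qed

end
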